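(* Let $S=k[x_1,\dots,x_n]$ be a polynomial ring over a field $k$, let $\mathcal L\subset\mathbb Z^n$ be a sublattice containing no nonzero nonnegative vectors, and suppose that the lattice ideal $I_{\mathcal L}\subset S$ is generic. Let $M$ be the initial ideal of $I_{\mathcal L}$ with respect to a reverse lexicographic term order. Then $M$ is a generic monomial ideal.
   Context: Lattice ideal: $I_{\mathcal L}=\langle \mathbf x^{\mathbf a}-\mathbf x^{\mathbf b} : \mathbf a,\mathbf b\in\mathbb N^n,\ \mathbf a-\mathbf b\in\mathcal L\rangle\subset S$, where $\mathbf x^{\mathbf a}=x_1^{a_1}\cdots x_n^{a_n}$. It is homogeneous with respect to some grading in which every $\deg(x_s)$ is a positive integer. Generic lattice ideal: $I_{\mathcal L}$ is generic if it is generated by binomials with full support, i.e. $I_{\mathcal L}=\langle \mathbf x^{\mathbf a_1}-\mathbf x^{\mathbf b_1},\dots,\mathbf x^{\mathbf a_r}-\mathbf x^{\mathbf b_r}\rangle$ where none of the vectors $\mathbf a_i-\mathbf b_i\in\mathbb Z^n$ has a zero coordinate. Reverse lexicographic term order: for some ordering of the variables, monomials are compared first by degree (with respect to a positive grading making $I_{\mathcal L}$ homogeneous), and ties are broken reverse lexicographically. Generic monomial ideal: for a monomial put $\operatorname{supp}(\mathbf x^{\mathbf a})=\{s:a_s\ne 0\}$. A monomial ideal $M$ with minimal monomial generators $m_1,\dots,m_r$ is called generic if for any two distinct minimal generators $m_i,m_j$ which have the same positive degree in some variable $x_s$ there exists a third minimal generator $m_l$ of $M$ which divides $m_{\{i,j\}}=\operatorname{lcm}(m_i,m_j)$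 and satisfies $\operatorname{supp}(m_{\{i,j\}}/m_l)=\operatorname{supp}(m_{\{i,j\}})$. *)

theory Defs
  imports Complex_Main "HOL-Library.Poly_Mapping" "HOL-Library.Function_Algebras"
begin

text \<open>
  The variables \<open>x\<^sub>s\<close> are indexed by a finite type \<open>'v\<close>. Exponent vectors are functions
  \<open>'v \<Rightarrow> nat\<close> with pointwise operations, so on monomials addition is multiplication, \<open>\<le>\<close> is
  divisibility, \<open>sup\<close> is the least common multiple, and \<open>-\<close> is division whenever the
  subtrahend divides.
\<close>

type_synonym 'v expo = "'v \<Rightarrow> nat"

type_synonym ('v, 'k) mpoly = "'v expo \<Rightarrow>\<^sub>0 'k"

abbreviation xmon :: "'v expo \<Rightarrow> ('v, 'k::field) mpoly" where
  "xmon a \<equiv> Poly_Mapping.single a 1"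

text \<open>
  A commutative ring as a module over itself: \<open>ideal.span F\<close> is the ideal generated by \<open>F\<close>.
\<close>

global_interpretation ideal: module "(*) :: 'a::comm_ring_1 \<Rightarrow> 'a \<Rightarrow> 'a"
  by standard (simp_all add: algebra_simps)

definition sublattice :: "('v \<Rightarrow> int) set \<Rightarrow> bool" where
  "sublattice L \<longleftrightarrow> 0 \<in> L \<and> (\<forall>u\<in>L. \<forall>v\<in>L. u - v \<in> L)"

definition expo_diff :: "'v expo \<Rightarrow> 'v expo \<Rightarrow> 'v \<Rightarrow> int" where
  "expo_diff a b = (\<lambda>s. int (a s) - int (b s))"

definition lattice_ideal :: "('v \<Rightarrow> int) set \<Rightarrow> ('v, 'k::field) mpoly set" where
  "lattice_ideal L = ideal.span {xmon a - xmon b | a b. expo_diff a b \<in> L}"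

definition generic_lattice_ideal :: "('v, 'k::field) mpoly set \<Rightarrow> bool" where
  "generic_lattice_ideal I \<longleftrightarrow>
     (\<exists>B. finite B \<and> I = ideal.span {xmon a - xmon b | a b. (a, b) \<in> B} \<and>
          (\<forall>(a, b)\<in>B. \<forall>s. expo_diff a b s \<noteq> 0))"

definition wdeg :: "('v::finite \<Rightarrow> nat) \<Rightarrow> 'v expo \<Rightarrow> nat" where
  "wdeg d a = (\<Sum>s\<in>UNIV. d s * a s)"

definition homogeneous_poly :: "('v::finite \<Rightarrow> nat) \<Rightarrow> ('v, 'k::field) mpoly \<Rightarrow> bool" where
  "homogeneous_poly d f \<longleftrightarrow> (\<exists>e. \<forall>a\<in>Poly_Mapping.keys f. wdeg d a = e)"

definition homogeneous_ideal :: "('v::finite \<Rightarrow> nat) \<Rightarrow> ('v, 'k::field) mpoly set \<Rightarrow> bool" where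
  "homogeneous_ideal d I \<longleftrightarrow> (\<exists>F. (\<forall>f\<in>F. homogeneous_poly d f) \<and> I = ideal.span F)"

text \<open>
  \<open>pos s\<close> is the position of \<open>x\<^sub>s\<close> when the variables are listed from largest to smallest.
  Among monomials of equal degree the smaller one is the one with the larger exponent at the
  last position where the two differ.
\<close>

definition revlex_less :: "('v::finite \<Rightarrow> nat) \<Rightarrow> ('v \<Rightarrow> nat) \<Rightarrow> 'v expo \<Rightarrow> 'v expo \<Rightarrow> bool" where
  "revlex_less d pos a b \<longleftrightarrow>
     wdeg d a < wdeg d b \<or>
     wdeg d a = wdeg d b \<and> (\<exists>s. a s > b s \<and> (\<forall>t. pos t > pos s \<longrightarrow> a t = b t))"

definition is_lead_expo ::
    "('v expo \<Rightarrow> 'v expo \<Rightarrow> bool) \<Rightarrow> ('v, 'k::field) mpoly \<Rightarrow> 'v expo \<Rightarrow> bool" where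
  "is_lead_expo lt f a \<longleftrightarrow>
     a \<in> Poly_Mapping.keys f \<and> (\<forall>b\<in>Poly_Mapping.keys f. b \<noteq> a \<longrightarrow> lt b a)"

definition initial_ideal ::
    "('v expo \<Rightarrow> 'v expo \<Rightarrow> bool) \<Rightarrow> ('v, 'k::field) mpoly set \<Rightarrow> ('v, 'k) mpoly set" where
  "initial_ideal lt I = ideal.span {xmon a | a f. f \<in> I \<and> is_lead_expo lt f a}"

definition minimal_monomial_generators ::
    "'v expo set \<Rightarrow> ('v, 'k::field) mpoly set \<Rightarrow> bool" where
  "minimal_monomial_generators G M \<longleftrightarrow>
     finite G \<and> M = ideal.span (xmon ` G) \<and> (\<forall>H. H \<subset> G \<longrightarrow> ideal.span (xmon ` H) \<noteq> M)"

definition supp :: "'v expo \<Rightarrow> 'v set" where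
  "supp a = {s. a s \<noteq> 0}"

text \<open>
  The minimal generating set of a monomial ideal is unique; its existence is what makes \<open>M\<close> a
  monomial ideal.
\<close>

definition generic_monomial_ideal :: "('v, 'k::field) mpoly set \<Rightarrow> bool" where
  "generic_monomial_ideal M \<longleftrightarrow>
     (\<exists>G. minimal_monomial_generators G M \<and>
        (\<forall>a\<in>G. \<forall>b\<in>G. a \<noteq> b \<and> (\<exists>s. a s = b s \<and> a s > 0) \<longrightarrow>
           (\<exists>c\<in>G. c \<noteq> a \<and> c \<noteq> b \<and> c \<le> sup a b \<and> supp (sup a b - c) = supp (sup a b))))"

end

theory Submission
  imports Defs
begin

text \<open>
  Since \<open>x\<^sup>u - x\<^sup>v\<close> can be divided by common monomial factors, genericity says that every monomial
  that is not alone in its fiber is divisible by \<open>x\<^sup>u\<close> for some binomial \<open>x\<^sup>u - x\<^sup>v\<close> of the ideal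
  such that every variable divides exactly one of \<open>x\<^sup>u\<close>, \<open>x\<^sup>v\<close>. The last variable divides no
  minimal generator of the initial ideal, so each minimal generator \<open>m\<close> is itself such an \<open>x\<^sup>u\<close>.

  Moving from \<open>p\<close> towards \<open>q\<close> inside a fiber with such a binomial dividing \<open>p / gcd(p, q)\<close> leads to
  a monomial that misses only variables dividing \<open>p\<close> but not \<open>q\<close>. Let \<open>l\<close> be the lcm of two minimal
  generators with equal positive degree in \<open>x\<^sub>s\<close>. Replacing each of the two by its partner gives
  distinct \<open>p\<close>, \<open>q\<close> in the fiber of \<open>l\<close>, both prime to \<open>x\<^sub>s\<close>. A move from \<open>p\<close> towards \<open>q\<close> produces
  \<open>y \<noteq> q\<close>, and a move from \<open>q\<close> towards \<open>y\<close> then produces a monomial divisible by every variable.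
  Dividing it and \<open>l\<close> by the product of the variables in \<open>supp l\<close> shows that \<open>l\<close> over this product
  is in the initial ideal, and any minimal generator dividing it is the required third one.
\<close>

section \<open>Coefficient sums as linear functionals on polynomials\<close>

text \<open>The sum runs over the keys of \<open>f\<close> because \<open>T\<close> may be
  infinite.\<close>

definition coeff_sum :: "'a set \<Rightarrow> ('a \<Rightarrow>\<^sub>0 'k::comm_ring_1) \<Rightarrow> 'k" where
  "coeff_sum T f = (\<Sum>a\<in>Poly_Mapping.keys f. if a \<in> T then Poly_Mapping.lookup f a else 0)"

lemma coeff_sum_superset:
  assumes "finite A" "Poly_Mapping.keys f \<subseteq> A"
  shows "coeff_sum T f = (\<Sum>a\<in>A. if a \<in> T then Poly_Mapping.lookup f a else 0)"
  unfolding coeff_sum_def using assms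
  by (intro sum.mono_neutral_left) (auto simp: in_keys_iff)

lemma coeff_sum_zero [simp]: "coeff_sum T 0 = 0"
  by (simp add: coeff_sum_def)

lemma coeff_sum_add: "coeff_sum T (f + g) = coeff_sum T f + coeff_sum T g"
proof -
  let ?A = "Poly_Mapping.keys f \<union> Poly_Mapping.keys g"
  have "Poly_Mapping.keys (f + g) \<subseteq> ?A" by (rule Poly_Mapping.keys_add)
  then show ?thesis
    by (simp add: coeff_sum_superset[of ?A] sum.distrib[symmetric] lookup_add
        if_distrib cong: sum.cong if_cong)
qed

lemma coeff_sum_uminus: "coeff_sum T (- f) = - coeff_sum T f"
  by (simp add: coeff_sum_def sum_negf[symmetric]) (intro sum.cong, auto)

lemma coeff_sum_diff: "coeff_sum T (f - g) = coeff_sum T f - coeff_sum T g"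
  using coeff_sum_add[of T f "- g"] by (simp add: coeff_sum_uminus)

lemma coeff_sum_sum: "coeff_sum T (sum h A) = (\<Sum>i\<in>A. coeff_sum T (h i))"
  by (induction A rule: infinite_finite_induct) (auto simp: coeff_sum_add)

lemma coeff_sum_single [simp]:
  "coeff_sum T (Poly_Mapping.single a c) = (if a \<in> T then c else 0)"
  by (simp add: coeff_sum_def)

lemma sum_monomials:
  "(\<Sum>a\<in>Poly_Mapping.keys f. Poly_Mapping.single a (Poly_Mapping.lookup f a)) = f"
  by (rule poly_mapping_eqI) (simp add: lookup_sum lookup_single when_def in_keys_iff)

lemma coeff_sum_mult:
  fixes f g :: "'a::monoid_add \<Rightarrow>\<^sub>0 'k::comm_ring_1"
  shows "coeff_sum T (f * g) =
    (\<Sum>m\<in>Poly_Mapping.keys f. Poly_Mapping.lookup f m * coeff_sum {a. m + a \<in> T} g)"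
proof -
  have "f * g = (\<Sum>m\<in>Poly_Mapping.keys f. Poly_Mapping.single m (Poly_Mapping.lookup f m)) *
      (\<Sum>a\<in>Poly_Mapping.keys g. Poly_Mapping.single a (Poly_Mapping.lookup g a))"
    by (simp add: sum_monomials)
  also have "\<dots> = (\<Sum>m\<in>Poly_Mapping.keys f. \<Sum>a\<in>Poly_Mapping.keys g.
      Poly_Mapping.single (m + a) (Poly_Mapping.lookup f m * Poly_Mapping.lookup g a))"
    by (simp add: sum_product mult_single)
  finally show ?thesis
    by (simp add: coeff_sum_sum)
       (simp add: coeff_sum_def sum_distrib_left if_distrib cong: if_cong)
qed

text \<open>Each monomial \<open>m\<close> of a multiplier pulls \<open>T\<close> back to another
  member of the family, where the generator already sums to 0.\<close>

lemma coeff_sum_ideal_eq_0: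
  fixes F :: "('a::comm_monoid_add \<Rightarrow>\<^sub>0 'k::comm_ring_1) set"
  assumes "f \<in> ideal.span F" "T \<in> \<T>"
    and F: "\<And>g T. g \<in> F \<Longrightarrow> T \<in> \<T> \<Longrightarrow> coeff_sum T g = 0"
    and shift: "\<And>T m. T \<in> \<T> \<Longrightarrow> {a. m + a \<in> T} \<in> \<T>"
  shows "coeff_sum T f = 0"
proof -
  have "\<forall>T\<in>\<T>. coeff_sum T f = 0" using assms(1)
  proof (induction f rule: ideal.span_induct_alt)
    case base
    then show ?case by simp
  next
    case (step c x y)
    then show ?case
      by (simp add: coeff_sum_add coeff_sum_mult F shift)
  qed
  with assms(2) show ?thesis by blast
qed

text \<open>Each monomial of \<open>c * x\<close> is a product of one of \<open>c\<close> and one of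
  \<open>x\<close>, and addition creates no new monomials.\<close>

lemma keys_ideal_divisible:
  fixes F :: "('v expo \<Rightarrow>\<^sub>0 'k::comm_ring_1) set"
  assumes "f \<in> ideal.span F" "a \<in> Poly_Mapping.keys f"
  shows "\<exists>g\<in>F. \<exists>u\<in>Poly_Mapping.keys g. u \<le> a"
  using assms
proof (induction f rule: ideal.span_induct_alt)
  case base
  then show ?case by simp
next
  case (step c x y)
  from step.prems consider "a \<in> Poly_Mapping.keys (c * x)" | "a \<in> Poly_Mapping.keys y"
    using Poly_Mapping.keys_add[of "c * x" y] by blast
  then show ?case
  proof cases
    case 1
    then obtain m u where "a = m + u" "u \<in> Poly_Mapping.keys x"
      using keys_mult[of c x] by blast
    with step.hyps show ?thesis by (auto simp: le_fun_def intro!: bexI[of _ x] bexI[of _ u])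
  next
    case 2
    with step show ?thesis by blast
  qed
qed

lemma keys_xmon_diff:
  "Poly_Mapping.keys (xmon a - xmon b :: ('v, 'k::field) mpoly) = (if a = b then {} else {a, b})"
  by (auto simp: in_keys_iff lookup_minus lookup_single when_def)

lemma expo_diff_self [simp]: "expo_diff a a = 0"
  by (auto simp: expo_diff_def)

lemma expo_diff_replace: "u \<le> a \<Longrightarrow> expo_diff a (a - u + v) = expo_diff u v"
proof
  show "u \<le> a \<Longrightarrow> expo_diff a (a - u + v) t = expo_diff u v t" for t
    using le_funD[of u a t] by (simp add: expo_diff_def)
qed

lemma wdeg_add: "wdeg d (a + b) = wdeg d a + wdeg d b"
  by (simp add: wdeg_def algebra_simps sum.distrib)

lemma revlex_less_add_iff [simp]: "revlex_less d pos (c + a) (c + b) \<longleftrightarrow> revlex_less d pos a b"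
  by (simp add: revlex_less_def wdeg_add)

section \<open>Lattice cosets and membership in the lattice ideal\<close>

context
  fixes L :: "('v::finite \<Rightarrow> int) set"
  assumes L: "sublattice L"
begin

lemma expo_diff_sym: "expo_diff a b \<in> L \<Longrightarrow> expo_diff b a \<in> L"
proof -
  have "expo_diff b a = 0 - expo_diff a b" by (auto simp: expo_diff_def)
  then show "expo_diff a b \<in> L \<Longrightarrow> expo_diff b a \<in> L"
    using L unfolding sublattice_def by metis
qed

lemma expo_diff_trans: "expo_diff a b \<in> L \<Longrightarrow> expo_diff b c \<in> L \<Longrightarrow> expo_diff a c \<in> L"
proof -
  have "expo_diff a c = expo_diff a b - expo_diff c b" by (auto simp: expo_diff_def)
  then show "expo_diff a b \<in> L \<Longrightarrow> expo_diff b c \<in> L \<Longrightarrow> expo_diff a c \<in> L"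
    using L expo_diff_sym[of b c] unfolding sublattice_def by metis
qed

lemma coset_diff_iff:
  assumes "expo_diff a b \<in> L"
  shows "(\<lambda>s. int (a s) - z s) \<in> L \<longleftrightarrow> (\<lambda>s. int (b s) - z s) \<in> L"
proof -
  have "(\<lambda>s. int (a s) - z s) = (\<lambda>s. int (b s) - z s) - expo_diff b a"
    "(\<lambda>s. int (b s) - z s) = (\<lambda>s. int (a s) - z s) - expo_diff a b"
    by (auto simp: expo_diff_def)
  then show ?thesis
    using L assms expo_diff_sym[OF assms] unfolding sublattice_def by metis
qed

text \<open>The offset \<open>z\<close> of a coset is an integer vector so that these families are closed under
  division by monomials.\<close>

definition coset :: "('v \<Rightarrow> int) \<Rightarrow> 'v expo set" where
  "coset z = {a. (\<lambda>s. int (a s) - z s) \<in> L}"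

text \<open>A generator has both of its exponents in a given coset or neither, so its coefficients
  cancel there.\<close>

lemma coeff_sum_coset_eq_0:
  assumes "f \<in> (lattice_ideal L :: ('v, 'k::field) mpoly set)"
  shows "coeff_sum (coset z) f = 0"
proof (rule coeff_sum_ideal_eq_0[of f _ _ "range coset"])
  show "f \<in> ideal.span {xmon a - xmon b | a b. expo_diff a b \<in> L}"
    using assms by (simp add: lattice_ideal_def)
next
  fix g :: "('v, 'k) mpoly" and T
  assume "g \<in> {xmon a - xmon b | a b. expo_diff a b \<in> L}" "T \<in> range coset"
  then show "coeff_sum T g = 0"
    by (auto simp: coeff_sum_diff coset_def dest: coset_diff_iff)
next
  fix T and m :: "'v expo"
  assume "T \<in> range coset"
  then obtain z where "T = coset z" by blast
  then have "{a. m + a \<in> T} = coset (\<lambda>s. z s - int (m s))"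
    by (simp add: coset_def algebra_simps)
  then show "{a. m + a \<in> T} \<in> range coset" by blast
qed simp

text \<open>The coset of \<open>b\<close> contains \<open>b\<close>, so a zero coefficient sum over
  it forces \<open>a\<close> into it as well.\<close>

lemma xmon_diff_in_lattice_ideal_iff:
  "(xmon a - xmon b :: ('v, 'k::field) mpoly) \<in> lattice_ideal L \<longleftrightarrow> expo_diff a b \<in> L"
proof
  assume "(xmon a - xmon b :: ('v, 'k) mpoly) \<in> lattice_ideal L"
  from coeff_sum_coset_eq_0[OF this, of "\<lambda>s. int (b s)"]
  have "(a \<in> coset (\<lambda>s. int (b s))) = (b \<in> coset (\<lambda>s. int (b s)))"
    by (auto simp: coeff_sum_diff split: if_splits)
  moreover have "b \<in> coset (\<lambda>s. int (b s))"
    using L by (simp add: coset_def sublattice_def zero_fun_def)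
  ultimately show "expo_diff a b \<in> L" by (simp add: coset_def expo_diff_def)
qed (auto simp: lattice_ideal_def intro: ideal.span_base)

text \<open>Cosets are refined by degree. The keys of a homogeneous generator share one degree, so
  its sum over a refined coset is 0 or the sum over the whole coset. The degree \<open>e\<close> is
  an integer so that the family is closed under division by monomials.\<close>

lemma wdeg_eq_of_homogeneous:
  assumes "homogeneous_ideal d (lattice_ideal L :: ('v, 'k::field) mpoly set)"
    and "expo_diff a b \<in> L"
  shows "wdeg d a = wdeg d b"
proof -
  define T where "T = (\<lambda>(z, e). {c \<in> coset z. int (wdeg d c) = e})"
  from assms(1) obtain F :: "('v, 'k) mpoly set" where
    F: "\<And>f. f \<in> F \<Longrightarrow> homogeneous_poly d f" and IF: "lattice_ideal L = ideal.span F"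
    unfolding homogeneous_ideal_def by blast
  have "coeff_sum (T (\<lambda>s. int (a s), int (wdeg d a))) (xmon a - xmon b :: ('v, 'k) mpoly) = 0"
  proof (rule coeff_sum_ideal_eq_0[of _ F _ "range T"])
    show "(xmon a - xmon b :: ('v, 'k) mpoly) \<in> ideal.span F"
      using assms(2) IF xmon_diff_in_lattice_ideal_iff by blast
  next
    fix f U assume "f \<in> F" "U \<in> range T"
    then obtain z e where U: "U = {c \<in> coset z. int (wdeg d c) = e}"
      by (auto simp: T_def)
    from F[OF \<open>f \<in> F\<close>] obtain e' where e': "\<And>c. c \<in> Poly_Mapping.keys f \<Longrightarrow> wdeg d c = e'"
      unfolding homogeneous_poly_def by blast
    have "coeff_sum (coset z) f = 0"
      using \<open>f \<in> F\<close> IF by (intro coeff_sum_coset_eq_0) (auto intro: ideal.span_base)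
    moreover have "coeff_sum U f = (if int e' = e then coeff_sum (coset z) f else 0)"
      unfolding coeff_sum_def by (auto simp: U e' intro!: sum.cong sum.neutral)
    ultimately show "coeff_sum U f = 0" by simp
  next
    fix U and m :: "'v expo"
    assume "U \<in> range T"
    then obtain z e where U: "U = {c \<in> coset z. int (wdeg d c) = e}"
      by (auto simp: T_def)
    have "{c. m + c \<in> U} = T (\<lambda>s. z s - int (m s), e - int (wdeg d m))"
      by (auto simp: U T_def coset_def wdeg_add algebra_simps)
    then show "{c. m + c \<in> U} \<in> range T" by blast
  qed simp
  moreover have "a \<in> T (\<lambda>s. int (a s), int (wdeg d a))"
    using L by (simp add: T_def coset_def sublattice_def zero_fun_def)
  ultimately have "b \<in> T (\<lambda>s. int (a s), int (wdeg d a))"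
    by (auto simp: coeff_sum_diff split: if_splits)
  then show ?thesis by (simp add: T_def)
qed

end

text \<open>This is what full support means for a binomial without common monomial factor.\<close>

definition complementary :: "'v expo \<Rightarrow> 'v expo \<Rightarrow> bool" where
  "complementary u v \<longleftrightarrow> (\<forall>t. u t = 0 \<longleftrightarrow> v t > 0)"

lemma complementaryD: "complementary u v \<Longrightarrow> u t = 0 \<longleftrightarrow> v t > 0"
  by (simp add: complementary_def)

section \<open>Moves inside a fiber\<close>

context
  fixes L :: "('v::finite \<Rightarrow> int) set" and B :: "('v expo \<times> 'v expo) set"
  assumes L: "sublattice L"
    and B_L: "\<And>u v. (u, v) \<in> B \<Longrightarrow> expo_diff u v \<in> L \<and> complementary u v"
    and B_div: "\<And>a b. expo_diff a b \<in> L \<Longrightarrow> a \<noteq> b \<Longrightarrow> \<exists>(u, v)\<in>B. u \<le> a"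
begin

text \<open>The move replaces a factor \<open>u\<close> of \<open>p / gcd(p, q)\<close> by
  \<open>v\<close>. A variable missing afterwards has \<open>v t = 0\<close>, hence
  \<open>u t > 0\<close>, and \<open>u\<close> uses up all of \<open>p t\<close>, which leaves the
  gcd no share at \<open>t\<close>.\<close>

lemma fiber_move:
  assumes "expo_diff p q \<in> L" "p \<noteq> q"
  obtains y where "expo_diff y p \<in> L" "\<And>t. y t = 0 \<Longrightarrow> p t > 0 \<and> q t = 0"
proof -
  have "expo_diff (p - inf p q) (q - inf p q) = expo_diff p q"
    by (auto simp: expo_diff_def inf_nat_def of_nat_diff)
  moreover have "p - inf p q \<noteq> q - inf p q"
  proof
    assume eq: "p - inf p q = q - inf p q"
    have "p t = q t" for t
      using fun_cong[OF eq, of t] by (auto simp: inf_nat_def min_def split: if_splits)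
    with assms(2) show False by blast
  qed
  ultimately obtain u v where uv: "(u, v) \<in> B" and u: "u \<le> p - inf p q"
    using B_div[of "p - inf p q" "q - inf p q"] assms(1) by auto
  have u': "u t + min (p t) (q t) \<le> p t" for t
    using le_funD[OF u, of t] by (auto simp: inf_nat_def)
  show thesis
  proof
    have "u \<le> p" by (rule le_funI) (use u' in \<open>metis add_leD1\<close>)
    then have "expo_diff p (p - u + v) \<in> L"
      using B_L[OF uv] by (simp add: expo_diff_replace)
    then show "expo_diff (p - u + v) p \<in> L" by (rule expo_diff_sym[OF L])
    show "p t > 0 \<and> q t = 0" if "(p - u + v) t = 0" for t
    proof -
      from that have "v t = 0" "p t \<le> u t" by auto
      moreover from this have "u t > 0" using B_L[OF uv] complementaryD[of u v t] by auto
      ultimately show ?thesis using u'[of t] by (auto simp: min_def split: if_splits)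
    qed
  qed
qed

text \<open>Here \<open>p\<close> and \<open>q\<close> need only share one missing variable: the first move repairs it, which
  keeps the result different from \<open>q\<close> and permits a second move.\<close>

lemma fiber_full_support:
  assumes "expo_diff p q \<in> L" "p \<noteq> q" "p s = 0" "q s = 0"
  obtains y where "expo_diff y p \<in> L" "\<And>t. y t > 0"
proof -
  obtain y where y: "expo_diff y p \<in> L" "\<And>t. y t = 0 \<Longrightarrow> p t > 0 \<and> q t = 0"
    using fiber_move[OF assms(1,2)] by blast
  have "q \<noteq> y" using y(2)[of s] assms(3,4) by auto
  moreover have "expo_diff q y \<in> L"
    using y(1) assms(1) expo_diff_trans[OF L] expo_diff_sym[OF L] by blast
  ultimately obtain z where z: "expo_diff z q \<in> L" "\<And>t. z t = 0 \<Longrightarrow> q t > 0 \<and> y t = 0"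
    using fiber_move by blast
  show thesis
  proof
    show "expo_diff z p \<in> L"
      using z(1) assms(1) expo_diff_trans[OF L] expo_diff_sym[OF L] by blast
    \<comment> \<open>A zero of \<open>z\<close> at \<open>t\<close> would need
      \<open>y t = 0\<close> and \<open>q t > 0\<close>, but \<open>y t = 0\<close> forces
      \<open>q t = 0\<close>.\<close>
    show "z t > 0" for t using y(2)[of t] z(2)[of t] by force
  qed
qed

end

section \<open>Generators of the lattice ideal and of its initial ideal\<close>

text \<open>Dividing a generator by the gcd of its terms keeps the exponent difference and turns
  full support into \<open>complementary\<close>. Both orientations are kept because either term may
  be the one dividing \<open>a\<close>.\<close>

lemma primitive_binomials:
  fixes L :: "('v::finite \<Rightarrow> int) set"
  assumes L: "sublattice L"
    and "generic_lattice_ideal (lattice_ideal L :: ('v, 'k::field) mpoly set)"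
  obtains B where "finite B"
    "\<And>u v. (u, v) \<in> B \<Longrightarrow> expo_diff u v \<in> L \<and> complementary u v"
    "\<And>a b. expo_diff a b \<in> L \<Longrightarrow> a \<noteq> b \<Longrightarrow> \<exists>(u, v)\<in>B. u \<le> a"
proof -
  from assms(2) obtain C where C: "finite C"
    and IC: "(lattice_ideal L :: ('v, 'k) mpoly set) =
      ideal.span {xmon a - xmon b | a b. (a, b) \<in> C}"
    and full: "\<And>a b s. (a, b) \<in> C \<Longrightarrow> expo_diff a b s \<noteq> 0"
    unfolding generic_lattice_ideal_def by blast
  define prim where "prim = (\<lambda>(u, v). (u - inf u v, v - inf u v) :: 'v expo \<times> 'v expo)"
  define B where "B = prim ` (C \<union> prod.swap ` C)"
  have C_L: "expo_diff a b \<in> L" if "(a, b) \<in> C" for a b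
  proof -
    have "(xmon a - xmon b :: ('v, 'k) mpoly) \<in> lattice_ideal L"
      unfolding IC using that by (intro ideal.span_base) blast
    then show ?thesis using xmon_diff_in_lattice_ideal_iff[OF L] by blast
  qed
  show thesis
  proof
    show "finite B" using C by (simp add: B_def)
  next
    fix u v assume "(u, v) \<in> B"
    then obtain a b where ab: "(a, b) \<in> C \<or> (b, a) \<in> C" and uv: "(u, v) = prim (a, b)"
      unfolding B_def by fastforce
    have "expo_diff u v = expo_diff a b"
      using uv by (auto simp: expo_diff_def prim_def inf_nat_def of_nat_diff)
    moreover have "expo_diff a b \<in> L" using ab C_L expo_diff_sym[OF L] by blast
    moreover have "u t = 0 \<longleftrightarrow> v t > 0" for t
    proof -
      have "a t \<noteq> b t"
        using ab full[of a b t] full[of b a t] by (auto simp: expo_diff_def)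
      then show ?thesis using uv by (simp add: prim_def inf_nat_def) linarith
    qed
    then have "complementary u v" by (simp add: complementary_def)
    ultimately show "expo_diff u v \<in> L \<and> complementary u v" by simp
  next
    fix a b :: "'v expo" assume ab: "expo_diff a b \<in> L" "a \<noteq> b"
    then have in_span: "(xmon a - xmon b :: ('v, 'k) mpoly) \<in>
        ideal.span {xmon a - xmon b | a b. (a, b) \<in> C}"
      using xmon_diff_in_lattice_ideal_iff[OF L] IC by blast
    have "a \<in> Poly_Mapping.keys (xmon a - xmon b :: ('v, 'k) mpoly)"
      using ab by (simp add: keys_xmon_diff)
    from keys_ideal_divisible[OF in_span this] obtain g :: "('v, 'k) mpoly" and w
      where g: "g \<in> {xmon a - xmon b | a b. (a, b) \<in> C}" "w \<in> Poly_Mapping.keys g" "w \<le> a"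
      by blast
    then obtain u v where uv: "(u, v) \<in> C" "g = xmon u - xmon v" by blast
    have "fst (prim (x, y)) \<le> x" for x y :: "'v expo"
      by (auto simp: prim_def le_fun_def)
    then have "fst (prim (u, v)) \<le> a \<or> fst (prim (v, u)) \<le> a"
      using g uv by (auto simp: keys_xmon_diff split: if_splits intro: order_trans)
    moreover have "prim (u, v) \<in> B" "prim (v, u) \<in> B"
      using uv(1) by (force simp: B_def)+
    ultimately show "\<exists>(u, v)\<in>B. u \<le> a" by (force simp: case_prod_beta)
  qed
qed

lemma minimal_monomial_generators_minimals:
  fixes E :: "'v::finite expo set"
  defines "G \<equiv> {m \<in> E. \<forall>a\<in>E. a \<le> m \<longrightarrow> a = m}"
  assumes "finite G"
  shows "minimal_monomial_generators G (ideal.span (xmon ` E) :: ('v, 'k::field) mpoly set)"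
    and "\<And>a. a \<in> E \<Longrightarrow> \<exists>m\<in>G. m \<le> a"
proof -
  show below: "\<exists>m\<in>G. m \<le> a" if "a \<in> E" for a
    using that
  proof (induction "sum a UNIV" arbitrary: a rule: less_induct)
    case less
    show ?case
    proof (cases "a \<in> G")
      case False
      then obtain b where b: "b \<in> E" "b \<le> a" "b \<noteq> a" using less.prems by (auto simp: G_def)
      then obtain t where "b t < a t" by (metis le_funD antisym_conv2 ext)
      then have "sum b UNIV < sum a UNIV"
        using b(2) by (intro sum_strict_mono_ex1) (auto simp: le_fun_def)
      then show ?thesis using less.hyps b by (meson order_trans)
    qed auto
  qed
  have "(xmon ` E :: ('v, 'k) mpoly set) \<subseteq> ideal.span (xmon ` G)"
  proof clarify
    fix a assume "a \<in> E"
    then obtain m where m: "m \<in> G" "m \<le> a" using below by blast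
    have "(xmon a :: ('v, 'k) mpoly) = xmon (a - m) * xmon m"
      using m(2) by (simp add: mult_single le_fun_def plus_fun_def)
    then show "(xmon a :: ('v, 'k) mpoly) \<in> ideal.span (xmon ` G)"
      using m(1) by (simp add: ideal.span_scale ideal.span_base)
  qed
  moreover have "G \<subseteq> E" by (auto simp: G_def)
  ultimately have "(ideal.span (xmon ` E) :: ('v, 'k) mpoly set) = ideal.span (xmon ` G)"
    by (intro antisym ideal.span_minimal ideal.span_mono image_mono) auto
  moreover have "ideal.span (xmon ` H) \<noteq> (ideal.span (xmon ` G) :: ('v, 'k) mpoly set)"
    if "H \<subset> G" for H
  proof
    assume eq: "ideal.span (xmon ` H) = (ideal.span (xmon ` G) :: ('v, 'k) mpoly set)"
    from that obtain m where m: "m \<in> G" "m \<notin> H" by blast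
    then have "(xmon m :: ('v, 'k) mpoly) \<in> ideal.span (xmon ` H)"
      unfolding eq by (intro ideal.span_base) blast
    from keys_ideal_divisible[OF this, of m] obtain h where "h \<in> H" "h \<le> m" by auto
    then have "h = m" using that m(1) by (auto simp: G_def)
    with \<open>h \<in> H\<close> m(2) show False by blast
  qed
  ultimately show "minimal_monomial_generators G
      (ideal.span (xmon ` E) :: ('v, 'k::field) mpoly set)"
    using assms(2) by (simp add: minimal_monomial_generators_def)
qed

text \<open>If nothing smaller lies in the coset of \<open>a\<close>, then \<open>a\<close> is the
  only key of \<open>f\<close> in it, so the vanishing coset sum equals the leading coefficient,
  which is absurd. Conversely a binomial serves as \<open>f\<close>.\<close>

lemma lead_expo_lattice_ideal:
  fixes L :: "('v::finite \<Rightarrow> int) set"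
  assumes L: "sublattice L" and irr: "\<And>a. \<not> lt a a"
  shows "(\<exists>f. f \<in> (lattice_ideal L :: ('v, 'k::field) mpoly set) \<and> is_lead_expo lt f a) \<longleftrightarrow>
    (\<exists>b. expo_diff a b \<in> L \<and> lt b a)" (is "?l \<longleftrightarrow> ?r")
proof
  assume ?l
  then obtain f :: "('v, 'k) mpoly" where f: "f \<in> lattice_ideal L" "is_lead_expo lt f a" by blast
  show ?r
  proof (rule ccontr)
    assume contra: "\<not> ?r"
    have "coeff_sum (coset L (\<lambda>s. int (a s))) f =
        (\<Sum>c\<in>Poly_Mapping.keys f. if c = a then Poly_Mapping.lookup f c else 0)"
      unfolding coeff_sum_def
    proof (intro sum.cong refl)
      fix c assume c: "c \<in> Poly_Mapping.keys f"
      have "c \<in> coset L (\<lambda>s. int (a s)) \<longleftrightarrow> expo_diff c a \<in> L"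
        by (simp add: coset_def[OF L] expo_diff_def)
      also have "\<dots> \<longleftrightarrow> c = a"
        using c f(2) contra L expo_diff_sym[OF L]
        by (auto simp: is_lead_expo_def sublattice_def)
      finally show "(if c \<in> coset L (\<lambda>s. int (a s)) then Poly_Mapping.lookup f c else 0) =
        (if c = a then Poly_Mapping.lookup f c else 0)" by simp
    qed
    also have "\<dots> = Poly_Mapping.lookup f a"
      using f(2) by (simp add: is_lead_expo_def)
    finally have "Poly_Mapping.lookup f a = 0"
      using coeff_sum_coset_eq_0[OF L f(1)] by simp
    then show False using f(2) by (simp add: is_lead_expo_def in_keys_iff)
  qed
next
  assume ?r
  then obtain b where b: "expo_diff a b \<in> L" "lt b a" by blast
  then have "a \<noteq> b" using irr by blast
  with b show ?l
    by (intro exI[of _ "xmon a - xmon b"])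
      (simp add: xmon_diff_in_lattice_ideal_iff[OF L] is_lead_expo_def keys_xmon_diff)
qed

section \<open>Minimal generators and their least common multiples\<close>

theorem theorem3p1:
  fixes L :: "('v::finite \<Rightarrow> int) set"
    and I M :: "('v, 'k::field) mpoly set"
    and d pos :: "'v \<Rightarrow> nat"
  assumes "sublattice L"
    and "\<forall>u\<in>L. 0 \<le> u \<longrightarrow> u = 0"
    and "I = lattice_ideal L"
    and "generic_lattice_ideal I"
    and "\<forall>s. d s > 0"
    and "homogeneous_ideal d I"
    and "bij_betw pos UNIV {..<card (UNIV :: 'v set)}"
    and "M = initial_ideal (revlex_less d pos) I"
  shows "generic_monomial_ideal M"
proof -
  note L = assms(1)
  let ?lt = "revlex_less d pos"
  define E where "E = {a. \<exists>b. expo_diff a b \<in> L \<and> ?lt b a}"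
  define G where "G = {m \<in> E. \<forall>a\<in>E. a \<le> m \<longrightarrow> a = m}"
  obtain B where B: "finite B"
    "\<And>u v. (u, v) \<in> B \<Longrightarrow> expo_diff u v \<in> L \<and> complementary u v"
    "\<And>a b. expo_diff a b \<in> L \<Longrightarrow> a \<noteq> b \<Longrightarrow> \<exists>(u, v)\<in>B. u \<le> a"
    using primitive_binomials[OF L] assms(3,4) by metis
  have hom: "wdeg d a = wdeg d b" if "expo_diff a b \<in> L" for a b
    using wdeg_eq_of_homogeneous[OF L] assms(3,6) that by blast
  have full: "\<exists>y. expo_diff y p \<in> L \<and> (\<forall>t. y t > 0)"
    if "expo_diff p q \<in> L" "p \<noteq> q" "p s = 0" "q s = 0" for p q s
    by (rule fiber_full_support[of L B p q s, OF L _ _ that]) (use B(2,3) in blast)+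
  have irr: "\<not> ?lt a a" for a by (simp add: revlex_less_def)
  \<comment> \<open>\<open>n\<close> is the last variable; within a fiber degrees agree, so a
    difference at \<open>n\<close> decides the comparison.\<close>
  obtain n where n: "\<And>t. pos t \<le> pos n"
    using Max_in[of "range pos"] Max_ge[of "range pos"] by fastforce
  have inj: "inj pos" using assms(7) by (simp add: bij_betw_def)
  have less_of_last: "?lt b a" if "expo_diff a b \<in> L" "a n < b n" for a b
    using that n hom[OF that(1)] by (auto simp: revlex_less_def not_less[symmetric])

  have gen: "m n = 0 \<and> (\<exists>v. (m, v) \<in> B)" if m: "m \<in> G" for m
  proof -
    from m obtain b where b: "expo_diff m b \<in> L" "?lt b m" by (auto simp: G_def E_def)
    \<comment> \<open>Dividing \<open>m\<close> and \<open>b\<close> by their gcd preserves the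
      order, so minimality of \<open>m\<close> makes them coprime.\<close>
    have split: "inf m b + (m - inf m b) = m" "inf m b + (b - inf m b) = b"
      by (auto simp: inf_nat_def)
    have "expo_diff (m - inf m b) (b - inf m b) = expo_diff m b"
      by (auto simp: expo_diff_def inf_nat_def of_nat_diff)
    moreover have "?lt (b - inf m b) (m - inf m b)"
      using b(2) revlex_less_add_iff[of d pos "inf m b"] split by metis
    ultimately have "m - inf m b \<in> E"
      unfolding E_def using b(1) by (intro CollectI exI[of _ "b - inf m b"]) simp
    then have eq: "m - inf m b = m" using m by (auto simp: G_def le_fun_def)
    have "m n = 0 \<or> b n = 0"
      using fun_cong[OF eq, of n] by (auto simp: inf_nat_def min_def split: if_splits)
    \<comment> \<open>The last difference has \<open>m s < b s\<close>. If \<open>s\<close> is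
      \<open>n\<close>, coprimality gives \<open>m n = 0\<close>; otherwise \<open>m n = b n\<close>
      and both vanish.\<close>
    moreover obtain s where s: "m s < b s" "\<And>t. pos s < pos t \<Longrightarrow> b t = m t"
      using b hom[OF b(1)] by (auto simp: revlex_less_def)
    moreover have "s = n \<or> pos s < pos n" using n[of s] inj by (metis injD le_neq_implies_less)
    ultimately have mn: "m n = 0" by auto
    have "m \<noteq> b" using s by auto
    then obtain u v where uv: "(u, v) \<in> B" "u \<le> m" using B(3)[OF b(1)] by blast
    \<comment> \<open>As \<open>u\<close> divides \<open>m\<close>, it is prime to the last
      variable, so \<open>v\<close> is not and \<open>u\<close> is the leading term.\<close>
    have "u n < v n" using mn le_funD[OF uv(2), of n] B(2)[OF uv(1)] complementaryD[of u v n]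
      by auto
    then have "u \<in> E" using less_of_last B(2)[OF uv(1)] by (auto simp: E_def)
    then have "u = m" using m uv(2) by (auto simp: G_def)
    with uv mn show ?thesis by blast
  qed

  have "G \<subseteq> fst ` B" using gen by force
  then have "finite G" using B(1) finite_surj by blast
  note G = minimal_monomial_generators_minimals[of E, folded G_def, OF this]
  have "{xmon a :: ('v, 'k) mpoly | a f. f \<in> I \<and> is_lead_expo ?lt f a} = xmon ` E"
    using lead_expo_lattice_ideal[OF L, where lt = ?lt and 'k = 'k] irr
    by (auto simp: E_def assms(3))
  then have "minimal_monomial_generators G M"
    using G(1) assms(8) by (simp add: initial_ideal_def)
  moreover have "\<exists>c\<in>G. c \<noteq> a \<and> c \<noteq> b \<and> c \<le> sup a b \<and> supp (sup a b - c) = supp (sup a b)"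
    if ab: "a \<in> G" "b \<in> G" "a \<noteq> b" and s: "a s = b s" "a s > 0" for a b s
  proof -
    from gen ab(1,2) obtain a' b' where a': "(a, a') \<in> B" and b': "(b, b') \<in> B" by blast
    define l where "l = sup a b"
    have l: "a t \<le> l t" "b t \<le> l t" for t by (auto simp: l_def)
    have pa: "expo_diff l (l - a + a') \<in> L"
      using l a' B(2) by (simp add: expo_diff_replace le_fun_def)
    have pb: "expo_diff l (l - b + b') \<in> L"
      using l b' B(2) by (simp add: expo_diff_replace le_fun_def)
    \<comment> \<open>At \<open>t\<close> the left side is below \<open>l t\<close> when
      \<open>a t > 0\<close> and above it when \<open>a t = 0\<close>; likewise for
      \<open>b\<close>. Equality would thus recover \<open>a t = b t\<close>.\<close>
    have "l - a + a' \<noteq> l - b + b'"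
    proof
      assume eq: "l - a + a' = l - b + b'"
      have "a t = b t" for t
      proof -
        have eq_t: "l t - a t + a' t = l t - b t + b' t"
          using fun_cong[OF eq, of t] by (simp only: plus_fun_apply minus_apply)
        have "a t = 0 \<longleftrightarrow> a' t > 0"
          using B(2)[OF a'] complementaryD[of a a' t] by simp
        moreover have "b t = 0 \<longleftrightarrow> b' t > 0"
          using B(2)[OF b'] complementaryD[of b b' t] by simp
        ultimately show ?thesis
          using l[of t] eq_t by (cases "a t = 0"; cases "b t = 0") linarith+
      qed
      with ab(3) show False by blast
    qed
    moreover have "expo_diff (l - a + a') (l - b + b') \<in> L"
      using pa pb expo_diff_sym[OF L] expo_diff_trans[OF L] by blast
    moreover have "(l - a + a') s = 0" "(l - b + b') s = 0"
      using s B(2)[OF a'] B(2)[OF b'] complementaryD[of a a' s] complementaryD[of b b' s]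
      by (auto simp: l_def)
    ultimately obtain y where y: "expo_diff y (l - a + a') \<in> L" "\<And>t. y t > 0"
      using full by metis
    \<comment> \<open>Truncated subtraction makes \<open>r\<close> the quotient of \<open>l\<close>
      by the product of the variables in \<open>supp l\<close>; \<open>z\<close> is \<open>y\<close>
      over the same product, an exact division since \<open>y\<close> has full support.\<close>
    define r where "r = (\<lambda>t. l t - 1)"
    define z where "z = (\<lambda>t. y t - (if l t = 0 then 0 else 1))"
    have "expo_diff r z = expo_diff l y"
    proof
      fix t show "expo_diff r z t = expo_diff l y t"
        using y(2)[of t] by (auto simp: expo_diff_def r_def z_def of_nat_diff)
    qed
    then have "expo_diff r z \<in> L"
      using pa y(1) expo_diff_sym[OF L] expo_diff_trans[OF L] by metis
    \<comment> \<open>The product omits the last variable, so \<open>z\<close> keeps its positive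
      exponent there.\<close>
    moreover have "l n = 0" using gen[OF ab(1)] gen[OF ab(2)] by (simp add: l_def)
    then have "r n < z n" using y(2)[of n] by (simp add: r_def z_def)
    ultimately have "r \<in> E" using less_of_last by (auto simp: E_def)
    then obtain c where c: "c \<in> G" "c \<le> r" using G(2) by blast
    \<comment> \<open>The drop by 1 on \<open>supp l\<close> separates \<open>c\<close> from
      \<open>a\<close> and \<open>b\<close> at \<open>s\<close> and keeps the support of
      \<open>l - c\<close> full.\<close>
    have c_le: "c t \<le> l t - 1" for t using le_funD[OF c(2), of t] by (simp add: r_def)
    have "c s < l s" using c_le[of s] s(2) l(1)[of s] by linarith
    moreover have "l s = a s" "l s = b s" using s by (auto simp: l_def)
    ultimately have "c \<noteq> a" "c \<noteq> b" by auto
    moreover have "c \<le> l" using c_le by (auto simp: le_fun_def intro: order_trans[OF c_le])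
    moreover have "supp (l - c) = supp l"
    proof -
      have "l t - c t \<noteq> 0 \<longleftrightarrow> l t \<noteq> 0" for t using c_le[of t] by linarith
      then show ?thesis by (simp add: supp_def)
    qed
    ultimately show ?thesis using c(1) unfolding l_def by blast
  qed
  ultimately show ?thesis unfolding generic_monomial_ideal_def by blast
qed

end
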